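(* Let $(\mathbf{X},d)$ be a computable metric space with a computable Borel probability measure $\mu$ such that $\mu(B_r(x))$ depends only on $r$ and not on $x$ (for all $r>0$, $x\in\mathbf{X}$). Then $\mathbf{X}$ is computably compact.
   Context: A computable metric space is a complete metric space with a designated dense sequence on which the metric is computable, points represented as limits of fast converging sequences from it. $B_r(x)$ denotes the open ball of radius $r$ about $x$. A probability measure $\mu$ is computable if $\mu(U)$ can be approximated from below (as a lower real) uniformly in open sets $U$. $\mathbf{X}$ is computably compact if the set of open sets $U$ with $U=\mathbf{X}$ is semi-decidable. *)

theory Defs
  imports "HOL-Probability.Probability_Measure" "HOL-Library.Nat_Bijection" "HOL-Library.Countable"
begin

text \<open>
  Type-2 computability: a machine with oracle \<open>p :: nat \<Rightarrow> nat\<close> computes a partial function on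
  \<^typ>\<open>nat\<close>, uniformly in \<open>p\<close>.  Several arguments are passed as one through
  \<^const>\<open>prod_encode\<close>; divergence is \<^const>\<open>None\<close>.
\<close>

definition minimise :: "(nat \<Rightarrow> nat option) \<Rightarrow> nat option" where
  "minimise f =
     (if \<exists>m. f m = Some 0 \<and> (\<forall>j<m. f j \<noteq> None) then Some (LEAST m. f m = Some 0) else None)"

inductive partrec :: "((nat \<Rightarrow> nat) \<Rightarrow> nat \<Rightarrow> nat option) \<Rightarrow> bool" where
  zero: "partrec (\<lambda>p n. Some 0)"
| succ: "partrec (\<lambda>p n. Some (Suc n))"
| left: "partrec (\<lambda>p n. Some (fst (prod_decode n)))"
| right: "partrec (\<lambda>p n. Some (snd (prod_decode n)))"
| query: "partrec (\<lambda>p n. Some (p n))"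
| pair: "partrec F \<Longrightarrow> partrec G \<Longrightarrow>
    partrec (\<lambda>p n. Option.bind (F p n) (\<lambda>a. Option.bind (G p n) (\<lambda>b. Some (prod_encode (a, b)))))"
| comp: "partrec F \<Longrightarrow> partrec G \<Longrightarrow> partrec (\<lambda>p n. Option.bind (G p n) (F p))"
| prim_rec: "partrec F \<Longrightarrow> partrec G \<Longrightarrow>
    partrec (\<lambda>p n. rec_nat (F p (fst (prod_decode n)))
      (\<lambda>m v. Option.bind v (\<lambda>i. G p (prod_encode (fst (prod_decode n), prod_encode (m, i)))))
      (snd (prod_decode n)))"
| mu: "partrec F \<Longrightarrow> partrec (\<lambda>p n. minimise (\<lambda>m. F p (prod_encode (n, m))))"

text \<open>A function that does not depend on the oracle is computable in the ordinary sense.\<close>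

definition computable_fun :: "(nat \<Rightarrow> nat) \<Rightarrow> bool" where
  "computable_fun f \<longleftrightarrow> partrec (\<lambda>p n. Some (f n))"

text \<open>A representation is a relation: \<open>\<delta> p x\<close> says that \<open>p\<close> is a name of \<open>x\<close>.\<close>

type_synonym 'a rep = "(nat \<Rightarrow> nat) \<Rightarrow> 'a \<Rightarrow> bool"

definition computable_map :: "'a rep \<Rightarrow> 'b rep \<Rightarrow> ('a \<Rightarrow> 'b) \<Rightarrow> bool" where
  "computable_map \<delta> \<epsilon> f \<longleftrightarrow>
     (\<exists>F. partrec F \<and> (\<forall>p x. \<delta> p x \<longrightarrow> (\<exists>q. (\<forall>n. F p n = Some (q n)) \<and> \<epsilon> q (f x))))"

text \<open>The machine halts (on the dummy input 0) exactly on the names of elements of \<open>A\<close>; its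
  behaviour on oracles that name nothing is irrelevant.\<close>

definition semidecidable :: "'a rep \<Rightarrow> 'a set \<Rightarrow> bool" where
  "semidecidable \<delta> A \<longleftrightarrow>
     (\<exists>F. partrec F \<and> (\<forall>p x. \<delta> p x \<longrightarrow> (x \<in> A \<longleftrightarrow> F p 0 \<noteq> None)))"

definition rat_code :: "nat \<Rightarrow> real" where
  "rat_code n = real_of_rat (nat_to_rat_surj n)"

text \<open>Lower reals: a name enumerates rational lower bounds with supremum \<open>x\<close>.\<close>

definition lower_real_rep :: "real rep" where
  "lower_real_rep p x \<longleftrightarrow>
     bdd_above (range (\<lambda>n. rat_code (p n))) \<and> x = (SUP n. rat_code (p n))"

definition computable_metric :: "(nat \<Rightarrow> 'a :: complete_space) \<Rightarrow> bool" where
  "computable_metric \<alpha> \<longleftrightarrow> closure (range \<alpha>) = UNIV \<and>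
     (\<exists>f. computable_fun f \<and>
       (\<forall>i j k. \<bar>dist (\<alpha> i) (\<alpha> j) - rat_code (f (prod_encode (i, prod_encode (j, k))))\<bar> \<le> 1 / 2 ^ k))"

definition point_rep :: "(nat \<Rightarrow> 'a :: complete_space) \<Rightarrow> 'a rep" where
  "point_rep \<alpha> q x \<longleftrightarrow> (\<forall>n. dist (\<alpha> (q n)) x < 1 / 2 ^ n)"

text \<open>
  Open sets are represented as continuous maps into Sierpinski space: a name of \<open>U\<close> enumerates
  finite words (0 stands for no word) such that a point is in \<open>U\<close> iff a word from the enumeration
  is a prefix of its name, for any of the names of that point.
\<close>

definition open_rep :: "(nat \<Rightarrow> 'a :: complete_space) \<Rightarrow> 'a set rep" where
  "open_rep \<alpha> p U \<longleftrightarrow> open U \<and>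
     (\<forall>q x. point_rep \<alpha> q x \<longrightarrow>
       (x \<in> U \<longleftrightarrow> (\<exists>n k. p n = Suc (list_encode (map q [0..<k])))))"

definition computable_measure :: "(nat \<Rightarrow> 'a :: complete_space) \<Rightarrow> 'a measure \<Rightarrow> bool" where
  "computable_measure \<alpha> M \<longleftrightarrow> computable_map (open_rep \<alpha>) lower_real_rep (measure M)"

definition computably_compact :: "(nat \<Rightarrow> 'a :: complete_space) \<Rightarrow> bool" where
  "computably_compact \<alpha> \<longleftrightarrow> semidecidable (open_rep \<alpha>) {U. U = UNIV}"

end

(*
  All balls of radius r have the same positive measure g(r), so any set V with mu(V) + g(r) > 1
  meets every ball of radius r.  A word w in a name of U stands for the intersection of the balls
  B(alpha(w_i), 2^-i); let V_k be the union of these sets with all radii reduced by 2^-k.  Then mu(V_k) + g(2^-k) > 1 already forces U to be the whole space.  Conversely the measure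
  argument makes the space totally bounded, hence compact, so U = X gives V_k = X for some k.
  Both measures are lower semicomputable, so the inequality can be searched for.
*)
theory Submission
  imports Defs
begin

text \<open>Largeness in measure alone cannot show that \<open>U\<close> is everything: an open set
  of measure 1 may still miss a null set. The reduction of the radii repairs this. A point closer
  than \<open>2^-k\<close> to some point of the reduced intersection for a word \<open>w\<close>
  satisfies the unreduced inequalities, hence has a name that starts with \<open>w\<close>; and a
  name of \<open>U\<close> must judge all names of a point alike. So meeting a ball already puts its
  centre into \<open>U\<close>, with the same \<open>2^-k\<close> as radius and as reduction.
  Compactness only guarantees that a suitable \<open>k\<close> exists; no bound for it is computed.
  The sets \<open>V_k\<close> belong to the name of \<open>U\<close>, not to \<open>U\<close>
  itself. Their names have to be computed from that name, uniformly in \<open>k\<close>, and the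
  machine for the measure then has to run on an oracle that is itself computed. This is what the
  recursion theory below is for.\<close>

section \<open>Total functions and decidable tests relative to an oracle\<close>

definition total_rec :: "((nat \<Rightarrow> nat) \<Rightarrow> nat \<Rightarrow> nat) \<Rightarrow> bool" where
  "total_rec f \<longleftrightarrow> partrec (\<lambda>p n. Some (f p n))"

definition decidable :: "((nat \<Rightarrow> nat) \<Rightarrow> nat \<Rightarrow> bool) \<Rightarrow> bool" where
  "decidable P \<longleftrightarrow> total_rec (\<lambda>p n. of_bool (P p n))"

abbreviation pfst :: "nat \<Rightarrow> nat" where "pfst n \<equiv> fst (prod_decode n)"
abbreviation psnd :: "nat \<Rightarrow> nat" where "psnd n \<equiv> snd (prod_decode n)"

lemma partrec_comp_total: "partrec F \<Longrightarrow> total_rec g \<Longrightarrow> partrec (\<lambda>p n. F p (g p n))"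
  unfolding total_rec_def by (drule (1) partrec.comp) simp

lemma total_rec_comp: "total_rec f \<Longrightarrow> total_rec g \<Longrightarrow> total_rec (\<lambda>p n. f p (g p n))"
  using partrec_comp_total[of "\<lambda>p n. Some (f p n)" g] by (simp add: total_rec_def)

lemma total_rec_Suc: "total_rec f \<Longrightarrow> total_rec (\<lambda>p n. Suc (f p n))"
  by (rule total_rec_comp[of "\<lambda>p. Suc"]) (simp_all add: total_rec_def partrec.succ)

lemma total_rec_fst: "total_rec f \<Longrightarrow> total_rec (\<lambda>p n. pfst (f p n))"
  by (rule total_rec_comp[of "\<lambda>p. pfst"]) (simp_all add: total_rec_def partrec.left)

lemma total_rec_snd: "total_rec f \<Longrightarrow> total_rec (\<lambda>p n. psnd (f p n))"
  by (rule total_rec_comp[of "\<lambda>p. psnd"]) (simp_all add: total_rec_def partrec.right)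

lemma total_rec_query: "total_rec f \<Longrightarrow> total_rec (\<lambda>p n. p (f p n))"
  by (rule total_rec_comp[of "\<lambda>p. p"]) (simp_all add: total_rec_def partrec.query)

lemma total_rec_pair:
  "total_rec f \<Longrightarrow> total_rec g \<Longrightarrow> total_rec (\<lambda>p n. prod_encode (f p n, g p n))"
  unfolding total_rec_def by (drule (1) partrec.pair) simp

lemma total_rec_id: "total_rec (\<lambda>p n. n)"
  using partrec.pair[OF partrec.left partrec.right] by (simp add: total_rec_def)

lemma total_rec_const: "total_rec (\<lambda>p n. c)"
proof (induction c)
  case 0
  then show ?case by (simp add: total_rec_def partrec.zero)
next
  case (Suc c)
  then show ?case by (rule total_rec_Suc)
qed

text \<open>The constructor \<open>prim_rec\<close> reads parameter and bound off one code; here the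
  bound is any computed value. In the third hypothesis the input codes \<open>(n, (i, v))\<close>:
  parameter, step index, current value.\<close>

lemma total_rec_rec_nat:
  assumes "total_rec f" "total_rec h"
    and "total_rec (\<lambda>p n. g p (pfst n) (pfst (psnd n)) (psnd (psnd n)))"
  shows "total_rec (\<lambda>p n. rec_nat (f p n) (g p n) (h p n))"
proof -
  let ?F = "\<lambda>p n. Some (f p n)"
  let ?G = "\<lambda>p n. Some (g p (pfst n) (pfst (psnd n)) (psnd (psnd n)))"
  have eq: "rec_nat (?F p a) (\<lambda>m v. Option.bind v (\<lambda>i. ?G p (prod_encode (a, prod_encode (m, i))))) k
      = Some (rec_nat (f p a) (g p a) k)" for p a k
    by (induction k) simp_all
  have "partrec ?F" "partrec ?G" using assms by (simp_all add: total_rec_def)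
  then have "partrec (\<lambda>p n. Some (rec_nat (f p (pfst n)) (g p (pfst n)) (psnd n)))"
    using partrec.prim_rec[of ?F ?G] unfolding eq by blast
  then have "total_rec (\<lambda>p n. rec_nat (f p (pfst n)) (g p (pfst n)) (psnd n))"
    by (simp add: total_rec_def)
  from total_rec_comp[OF this total_rec_pair[OF total_rec_id assms(2)]] show ?thesis by simp
qed

lemmas total_rec_basic =
  total_rec_Suc total_rec_fst total_rec_snd total_rec_query total_rec_pair total_rec_id total_rec_const

lemma total_rec_add:
  assumes "total_rec f" "total_rec g"
  shows "total_rec (\<lambda>p n. f p n + g p n)"
proof -
  have "rec_nat a (\<lambda>i v. Suc v) b = a + b" for a b :: nat by (induction b) simp_all
  moreover have "total_rec (\<lambda>p n. rec_nat (f p n) (\<lambda>i v. Suc v) (g p n))"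
    by (intro total_rec_rec_nat total_rec_basic assms)
  ultimately show ?thesis by simp
qed

lemma total_rec_mult:
  assumes "total_rec f" "total_rec g"
  shows "total_rec (\<lambda>p n. f p n * g p n)"
proof -
  have "rec_nat 0 (\<lambda>i v. v + a) b = a * b" for a b :: nat by (induction b) simp_all
  moreover have "total_rec (\<lambda>p n. rec_nat 0 (\<lambda>i v. v + f p n) (g p n))"
    by (intro total_rec_rec_nat[where g = "\<lambda>p n i v. v + f p n"] total_rec_basic total_rec_add
          assms total_rec_comp[OF assms(1)])
  ultimately show ?thesis by simp
qed

lemma total_rec_diff:
  assumes "total_rec f" "total_rec g"
  shows "total_rec (\<lambda>p n. f p n - g p n)"
proof -
  \<comment> \<open>This recursion returns its last step index, which is the predecessor of
    \<open>b\<close> (and 0 for \<open>b = 0\<close>).\<close>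
  have pred: "rec_nat 0 (\<lambda>i v. i) b = b - 1" for b :: nat by (induction b) simp_all
  have "rec_nat a (\<lambda>i v. v - 1) b = a - b" for a b :: nat by (induction b) simp_all
  moreover have "total_rec (\<lambda>p n. rec_nat (f p n) (\<lambda>i v. rec_nat 0 (\<lambda>i v. i) v) (g p n))"
    by (intro total_rec_rec_nat total_rec_basic assms)
  ultimately show ?thesis by (simp add: pred)
qed

lemma total_rec_power2:
  assumes "total_rec f"
  shows "total_rec (\<lambda>p n. 2 ^ f p n)"
proof -
  have "rec_nat 1 (\<lambda>i v. v + v) b = (2 :: nat) ^ b" for b by (induction b) simp_all
  moreover have "total_rec (\<lambda>p n. rec_nat 1 (\<lambda>i v. v + v) (f p n))"
    by (intro total_rec_rec_nat total_rec_basic total_rec_add assms)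
  ultimately show ?thesis by simp
qed

lemma total_rec_mod2:
  assumes "total_rec f"
  shows "total_rec (\<lambda>p n. f p n mod 2)"
proof -
  have "rec_nat 0 (\<lambda>i v. 1 - v) b = b mod 2" for b :: nat
  proof (induction b)
    case (Suc b)
    then show ?case
      by (cases "even b") (auto simp: even_iff_mod_2_eq_zero odd_iff_mod_2_eq_one mod_Suc)
  qed simp
  moreover have "total_rec (\<lambda>p n. rec_nat 0 (\<lambda>i v. 1 - v) (f p n))"
    by (intro total_rec_rec_nat total_rec_basic total_rec_diff assms)
  ultimately show ?thesis by simp
qed

lemma total_rec_div2:
  assumes "total_rec f"
  shows "total_rec (\<lambda>p n. f p n div 2)"
proof -
  \<comment> \<open>There are \<open>b div 2\<close> odd numbers below \<open>b\<close>.\<close>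
  have "rec_nat 0 (\<lambda>i v. v + i mod 2) b = b div 2" for b :: nat
    by (induction b) (simp, simp, presburger)
  moreover have "total_rec (\<lambda>p n. rec_nat 0 (\<lambda>i v. v + i mod 2) (f p n))"
    by (intro total_rec_rec_nat total_rec_basic total_rec_mod2 total_rec_add assms)
  ultimately show ?thesis by simp
qed

lemma decidable_less:
  assumes "total_rec f" "total_rec g"
  shows "decidable (\<lambda>p n. f p n < g p n)"
proof -
  have "of_bool (a < b) = 1 - (1 - (b - a))" for a b :: nat by auto
  then show ?thesis unfolding decidable_def
    by (auto intro!: total_rec_diff total_rec_basic assms)
qed

lemma decidable_conj:
  assumes "decidable P" "decidable Q"
  shows "decidable (\<lambda>p n. P p n \<and> Q p n)"
  using total_rec_mult[OF assms[unfolded decidable_def]] by (simp add: decidable_def of_bool_conj)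

lemma decidable_not:
  assumes "decidable P"
  shows "decidable (\<lambda>p n. \<not> P p n)"
proof -
  have "of_bool (\<not> b) = 1 - (of_bool b :: nat)" for b by simp
  then show ?thesis using assms unfolding decidable_def
    by (auto intro!: total_rec_diff total_rec_basic)
qed

lemma decidable_imp:
  assumes "decidable P" "decidable Q"
  shows "decidable (\<lambda>p n. P p n \<longrightarrow> Q p n)"
  using decidable_not[OF decidable_conj[OF assms(1) decidable_not[OF assms(2)]]] by simp

lemma decidable_not_zero:
  assumes "total_rec f"
  shows "decidable (\<lambda>p n. f p n \<noteq> 0)"
  using decidable_less[OF total_rec_const[of 0] assms] by simp

lemma decidable_even:
  assumes "total_rec f"
  shows "decidable (\<lambda>p n. even (f p n))"
  using decidable_not[OF decidable_not_zero[OF total_rec_mod2[OF assms]]]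
  by (simp add: even_iff_mod_2_eq_zero)

lemma total_rec_if:
  assumes "decidable P" "total_rec f" "total_rec g"
  shows "total_rec (\<lambda>p n. if P p n then f p n else g p n)"
proof -
  have "(if b then x else y) = of_bool b * x + of_bool (\<not> b) * y" for b and x y :: nat by simp
  then show ?thesis using assms(1) decidable_not[OF assms(1)] unfolding decidable_def
    by (auto intro!: total_rec_add total_rec_mult assms(2,3))
qed

lemma decidable_all_less:
  assumes "decidable (\<lambda>p n. P p (pfst n) (psnd n))" "total_rec h"
  shows "decidable (\<lambda>p n. \<forall>i < h p n. P p n i)"
proof -
  have eq: "rec_nat 1 (\<lambda>i v. v * of_bool (P p n i)) b = (of_bool (\<forall>i<b. P p n i) :: nat)" for p n b
    by (induction b) (auto simp: less_Suc_eq)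
  have *: "total_rec (\<lambda>p n. of_bool (P p (pfst n) (pfst (psnd n))))"
    using total_rec_comp[OF assms(1)[unfolded decidable_def],
        of "\<lambda>p n. prod_encode (pfst n, pfst (psnd n))"]
    by (simp add: total_rec_basic)
  have "total_rec (\<lambda>p n. rec_nat 1 (\<lambda>i v. v * of_bool (P p n i)) (h p n))"
    by (intro total_rec_rec_nat[where g = "\<lambda>p n i v. v * of_bool (P p n i)"] total_rec_basic
        total_rec_mult assms(2) *)
  then show ?thesis unfolding eq decidable_def .
qed

section \<open>Computed oracles and unbounded search\<close>

text \<open>Each query of the machine is answered by computing \<open>r\<close>. The parameter
  \<open>pfst n\<close> selects the oracle, so every constructor must carry it along to all its
  submachines; the induction consists in rearranging codes accordingly.\<close>

lemma partrec_oracle_subst: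
  assumes "partrec F" and r: "total_rec (\<lambda>p n. r p (pfst n) (psnd n))"
  shows "partrec (\<lambda>p n. F (r p (pfst n)) (psnd n))"
  using assms(1)
proof induction
  case zero
  show ?case by (rule partrec.zero)
next
  case succ
  show ?case using total_rec_Suc[OF total_rec_snd[OF total_rec_id]] by (simp add: total_rec_def)
next
  case left
  show ?case using total_rec_fst[OF total_rec_snd[OF total_rec_id]] by (simp add: total_rec_def)
next
  case right
  show ?case using total_rec_snd[OF total_rec_snd[OF total_rec_id]] by (simp add: total_rec_def)
next
  case query
  show ?case using r by (simp add: total_rec_def)
next
  case (pair F G)
  from partrec.pair[OF pair.IH] show ?case .
next
  case (comp F G)
  \<comment> \<open>The inner machine passes the parameter on next to its result, because the outer
    one still has queries to answer.\<close>
  have "partrec (\<lambda>p n. Option.bind (G (r p (pfst n)) (psnd n))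
      (\<lambda>v. Some (prod_encode (pfst n, v))))"
    using partrec.pair[OF partrec.left comp.IH(2)] by simp
  from partrec.comp[OF comp.IH(1) this] show ?case by (simp add: bind_assoc)
next
  case (prim_rec F G)
  let ?g = "\<lambda>n. prod_encode (pfst (pfst n), prod_encode (psnd (pfst n), psnd n))"
  have "total_rec (\<lambda>p. ?g)" by (intro total_rec_basic)
  from partrec.prim_rec[OF prim_rec.IH(1) partrec_comp_total[OF prim_rec.IH(2) this]]
  have "partrec (\<lambda>p n. rec_nat (F (r p (pfst (pfst n))) (psnd (pfst n)))
      (\<lambda>m v. Option.bind v (\<lambda>i. G (r p (pfst (pfst n)))
         (prod_encode (psnd (pfst n), prod_encode (m, i))))) (psnd n))"
    by simp
  moreover have "total_rec (\<lambda>p n. prod_encode (prod_encode (pfst n, pfst (psnd n)), psnd (psnd n)))"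
    by (intro total_rec_basic)
  ultimately show ?case by (fastforce dest: partrec_comp_total)
next
  case (mu F)
  have "total_rec (\<lambda>p n. prod_encode (pfst (pfst n), prod_encode (psnd (pfst n), psnd n)))"
    by (intro total_rec_basic)
  from partrec.mu[OF partrec_comp_total[OF mu.IH this]] show ?case by simp
qed

lemma partrec_search:
  assumes "decidable P"
  shows "\<exists>F. partrec F \<and> (\<forall>p n. F p n \<noteq> None \<longleftrightarrow> (\<exists>m. P p (prod_encode (n, m))))"
proof -
  \<comment> \<open>\<open>minimise\<close> looks for the value 0, hence the negation; as the test
    is total, no earlier candidate can diverge.\<close>
  have "partrec (\<lambda>p n. Some (of_bool (\<not> P p n)))"
    using decidable_not[OF assms] by (simp add: decidable_def total_rec_def)
  then have "partrec (\<lambda>p n. minimise (\<lambda>m. Some (of_bool (\<not> P p (prod_encode (n, m))))))"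
    by (rule partrec.mu)
  moreover have "minimise (\<lambda>m. Some (of_bool (\<not> Q m))) \<noteq> None \<longleftrightarrow> (\<exists>m. Q m)" for Q :: "nat \<Rightarrow> bool"
    by (simp add: minimise_def)
  ultimately show ?thesis
    by (intro exI[of _ "\<lambda>p n. minimise (\<lambda>m. Some (of_bool (\<not> P p (prod_encode (n, m)))))"]) simp
qed

section \<open>Codes of finite words\<close>

text \<open>A nonempty word has the code \<open>Suc (prod_encode (head, code of tail))\<close>, so
  one step passes to the tail. The code 0 of the empty word is a fixed point since
  \<open>prod_decode 0 = (0, 0)\<close>; a nonzero result therefore means that position
  \<open>i\<close> exists.\<close>

definition word_drop :: "nat \<Rightarrow> nat \<Rightarrow> nat" where
  "word_drop c = rec_nat c (\<lambda>i v. psnd (v - 1))"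

definition word_nth :: "nat \<Rightarrow> nat \<Rightarrow> nat" where
  "word_nth c i = pfst (word_drop c i - 1)"

lemma prod_decode_0: "prod_decode 0 = (0, 0)"
  using prod_encode_inverse[of "(0, 0)"] by (simp add: prod_encode_def)

lemma word_drop_list_encode: "word_drop (list_encode xs) i = list_encode (drop i xs)"
proof (induction i)
  case (Suc i)
  have "psnd (list_encode ys - 1) = list_encode (tl ys)" for ys
    by (cases ys) (simp_all add: prod_decode_0)
  with Suc show ?case by (simp add: word_drop_def drop_Suc tl_drop)
qed (simp add: word_drop_def)

lemma list_encode_eq_0_iff: "list_encode xs = 0 \<longleftrightarrow> xs = []"
  by (cases xs) simp_all

lemma word_drop_eq_0_iff: "word_drop (list_encode xs) i = 0 \<longleftrightarrow> length xs \<le> i"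
  by (simp add: word_drop_list_encode list_encode_eq_0_iff)

lemma word_nth_list_encode: "i < length xs \<Longrightarrow> word_nth (list_encode xs) i = xs ! i"
  using Cons_nth_drop_Suc[of i xs, symmetric] by (simp add: word_nth_def word_drop_list_encode)

text \<open>Lets the code itself bound a quantifier over positions, so that no length has to be
  computed.\<close>

lemma length_le_list_encode: "length xs \<le> list_encode xs"
proof (induction xs)
  case (Cons x xs)
  also have "list_encode xs \<le> prod_encode (x, list_encode xs)" by (rule le_prod_encode_2)
  finally show ?case by simp
qed simp

lemma total_rec_word_drop:
  assumes "total_rec f" "total_rec g"
  shows "total_rec (\<lambda>p n. word_drop (f p n) (g p n))"
  unfolding word_drop_def
  by (intro total_rec_rec_nat[where g = "\<lambda>p n i v. psnd (v - 1)"] total_rec_basic total_rec_diff assms)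

lemma total_rec_word_nth:
  assumes "total_rec f" "total_rec g"
  shows "total_rec (\<lambda>p n. word_nth (f p n) (g p n))"
  unfolding word_nth_def by (intro total_rec_basic total_rec_diff total_rec_word_drop assms)

section \<open>Exact comparison of rationals in natural numbers\<close>

text \<open>Even codes stand for nonnegative integers, odd ones for negative integers, whence the
  \<open>Suc\<close> in \<open>int_neg\<close>.\<close>

definition int_pos :: "nat \<Rightarrow> nat" where
  "int_pos c = (if even c then c div 2 else 0)"

definition int_neg :: "nat \<Rightarrow> nat" where
  "int_neg c = (if even c then 0 else Suc (c div 2))"

lemma int_decode_pos_neg: "int_decode c = int (int_pos c) - int (int_neg c)"
  by (simp add: int_decode_def sum_decode_def int_pos_def int_neg_def)

text \<open>A code with denominator 0 stands for the rational 0; it is given the denominator 1 here.\<close>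

definition rat_pos :: "nat \<Rightarrow> nat" where
  "rat_pos n = (if even (psnd n) then int_pos (pfst n) else int_neg (pfst n)) * of_bool (psnd n \<noteq> 0)"

definition rat_neg :: "nat \<Rightarrow> nat" where
  "rat_neg n = (if even (psnd n) then int_neg (pfst n) else int_pos (pfst n)) * of_bool (psnd n \<noteq> 0)"

definition rat_den :: "nat \<Rightarrow> nat" where
  "rat_den n = int_pos (psnd n) + int_neg (psnd n) + of_bool (\<not> psnd n \<noteq> 0)"

lemma rat_den_pos: "rat_den n > 0"
  by (cases "psnd n = 0") (auto simp: rat_den_def int_pos_def int_neg_def)

lemma rat_code_eq: "rat_code n = (real (rat_pos n) - real (rat_neg n)) / real (rat_den n)"
proof -
  have "rat_code n = of_int (int_decode (pfst n)) / of_int (int_decode (psnd n))"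
    by (simp add: rat_code_def nat_to_rat_surj_def case_prod_unfold Let_def Fract_of_int_quotient of_rat_divide)
  also have "\<dots> = (real (int_pos (pfst n)) - real (int_neg (pfst n))) /
      (real (int_pos (psnd n)) - real (int_neg (psnd n)))"
    by (simp add: int_decode_pos_neg)
  also have "\<dots> = (real (rat_pos n) - real (rat_neg n)) / real (rat_den n)"
  proof (cases "even (psnd n)")
    case True
    then show ?thesis
      by (cases "psnd n = 0") (simp_all add: rat_pos_def rat_neg_def rat_den_def
          int_pos_def[of "psnd n"] int_neg_def[of "psnd n"] int_pos_def[of 0] int_neg_def[of 0])
  next
    case False
    \<comment> \<open>An odd code is a negative denominator. Its sign goes to the numerator, which
      swaps the positive and the negative part.\<close>
    have "(a - b) / (0 - c) = (b - a) / c" for a b c :: real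
      by (metis diff_0 minus_diff_eq minus_divide_divide)
    moreover have "psnd n \<noteq> 0" using False by (metis even_zero)
    ultimately show ?thesis
      using False by (simp add: rat_pos_def rat_neg_def rat_den_def
          int_pos_def[of "psnd n"] int_neg_def[of "psnd n"] del: diff_0 diff_0_right)
  qed
  finally show ?thesis .
qed

lemma total_rec_int_pos: "total_rec f \<Longrightarrow> total_rec (\<lambda>p n. int_pos (f p n))"
  unfolding int_pos_def by (intro total_rec_if decidable_even total_rec_basic total_rec_div2)

lemma total_rec_int_neg: "total_rec f \<Longrightarrow> total_rec (\<lambda>p n. int_neg (f p n))"
  unfolding int_neg_def by (intro total_rec_if decidable_even total_rec_basic total_rec_div2)

lemma total_rec_of_bool: "decidable P \<Longrightarrow> total_rec (\<lambda>p n. of_bool (P p n))"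
  by (simp add: decidable_def)

lemmas total_rec_rat_intros = total_rec_if decidable_even total_rec_basic total_rec_int_pos
  total_rec_int_neg total_rec_mult total_rec_add decidable_not decidable_not_zero total_rec_of_bool

lemma total_rec_rat_pos: "total_rec f \<Longrightarrow> total_rec (\<lambda>p n. rat_pos (f p n))"
  unfolding rat_pos_def by (intro total_rec_rat_intros)

lemma total_rec_rat_neg: "total_rec f \<Longrightarrow> total_rec (\<lambda>p n. rat_neg (f p n))"
  unfolding rat_neg_def by (intro total_rec_rat_intros)

lemma total_rec_rat_den: "total_rec f \<Longrightarrow> total_rec (\<lambda>p n. rat_den (f p n))"
  unfolding rat_den_def by (intro total_rec_rat_intros)

text \<open>Denominators are positive and can be cleared; negative parts change sides, so that only
  sums and products of natural numbers are compared and no truncated subtraction occurs.\<close>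

lemma decidable_rat_code_sum_gt_1:
  assumes "total_rec f" "total_rec g"
  shows "decidable (\<lambda>p n. 1 < rat_code (f p n) + rat_code (g p n))"
proof -
  have "1 < rat_code x + rat_code y \<longleftrightarrow>
      rat_den x * rat_den y + rat_neg x * rat_den y + rat_neg y * rat_den x
        < rat_pos x * rat_den y + rat_pos y * rat_den x" for x y
  proof -
    have "1 < rat_code x + rat_code y \<longleftrightarrow>
       real (rat_den x * rat_den y + rat_neg x * rat_den y + rat_neg y * rat_den x)
        < real (rat_pos x * rat_den y + rat_pos y * rat_den x)"
      unfolding rat_code_eq using rat_den_pos[of x] rat_den_pos[of y]
      by (simp add: field_simps)
    then show ?thesis by (simp only: of_nat_less_iff)
  qed
  then show ?thesis
    by (simp only:) (intro decidable_less total_rec_add total_rec_mult total_rec_rat_den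
        total_rec_rat_neg total_rec_rat_pos assms)
qed

lemma decidable_rat_code_less_power2:
  assumes "total_rec f" "total_rec l" "total_rec k" "total_rec i"
  shows "decidable (\<lambda>p n. rat_code (f p n) + 2 / 2 ^ l p n + 1 / 2 ^ k p n < 1 / 2 ^ i p n)"
proof -
  have "rat_code x + 2 / 2 ^ a + 1 / 2 ^ b < 1 / 2 ^ c \<longleftrightarrow>
      rat_pos x * (2 ^ a * 2 ^ b * 2 ^ c) + rat_den x * (2 * 2 ^ b * 2 ^ c + 2 ^ a * 2 ^ c)
        < rat_den x * (2 ^ a * 2 ^ b) + rat_neg x * (2 ^ a * 2 ^ b * 2 ^ c)" for x a b c
  proof -
    have "rat_code x + 2 / 2 ^ a + 1 / 2 ^ b < 1 / 2 ^ c \<longleftrightarrow>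
      real (rat_pos x * (2 ^ a * 2 ^ b * 2 ^ c) + rat_den x * (2 * 2 ^ b * 2 ^ c + 2 ^ a * 2 ^ c))
        < real (rat_den x * (2 ^ a * 2 ^ b) + rat_neg x * (2 ^ a * 2 ^ b * 2 ^ c))"
      unfolding rat_code_eq using rat_den_pos[of x]
      by (simp add: field_simps)
    then show ?thesis by (simp only: of_nat_less_iff)
  qed
  then show ?thesis
    by (simp only:) (intro decidable_less total_rec_add total_rec_mult total_rec_rat_den
        total_rec_rat_neg total_rec_rat_pos total_rec_power2 total_rec_const assms)
qed

section \<open>Testing distances through names of points\<close>

text \<open>
  The term \<open>2 / 2 ^ l\<close> absorbs both the error of the computed distance and the distance from
  \<open>\<alpha> a\<close> to a point that has \<open>a\<close> as the \<open>l\<close>-th entry of its name.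
\<close>

definition close_test :: "(nat \<Rightarrow> nat) \<Rightarrow> nat \<Rightarrow> nat \<Rightarrow> nat \<Rightarrow> nat \<Rightarrow> nat \<Rightarrow> bool" where
  "close_test f b a l k i \<longleftrightarrow>
     rat_code (f (prod_encode (b, prod_encode (a, l)))) + 2 / 2 ^ l + 1 / 2 ^ k < 1 / 2 ^ i"

lemma close_test_sound:
  assumes "\<bar>dist (\<alpha> b) (\<alpha> a) - rat_code (f (prod_encode (b, prod_encode (a, l))))\<bar> \<le> 1 / 2 ^ l"
    and "dist (\<alpha> a) x < 1 / 2 ^ l" and "close_test f b a l k i"
  shows "dist (\<alpha> b) x + 1 / 2 ^ k < 1 / 2 ^ i"
  using assms dist_triangle[of "\<alpha> b" x "\<alpha> a"] by (simp add: close_test_def abs_if split: if_splits)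

text \<open>All large \<open>l\<close> work, and not merely one, so that finitely many tests can be
  passed at a common position.\<close>

lemma eventually_close_test:
  assumes "\<And>a l. \<bar>dist (\<alpha> b) (\<alpha> a) - rat_code (f (prod_encode (b, prod_encode (a, l))))\<bar> \<le> 1 / 2 ^ l"
    and "point_rep \<alpha> q x" and "dist (\<alpha> b) x + 1 / 2 ^ k < 1 / 2 ^ i"
  shows "eventually (\<lambda>l. close_test f b (q l) l k i) sequentially"
proof -
  \<comment> \<open>The computed value exceeds \<open>dist (\<alpha> b) x\<close> by at most
    \<open>2 / 2 ^ l\<close>: the error of the computation and the step from
    \<open>\<alpha> (q l)\<close> to \<open>x\<close>. The test adds another
    \<open>2 / 2 ^ l\<close>.\<close>
  have "(\<lambda>l. 4 * (1 / 2) ^ l :: real) \<longlonglongrightarrow> 4 * 0"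
    by (intro tendsto_intros LIMSEQ_power_zero) simp
  then have "eventually (\<lambda>l. 4 * (1 / 2) ^ l < 1 / 2 ^ i - 1 / 2 ^ k - dist (\<alpha> b) x) sequentially"
    by (rule order_tendstoD(2)) (use assms(3) in simp)
  then show ?thesis
  proof eventually_elim
    case (elim l)
    have "dist (\<alpha> (q l)) x < 1 / 2 ^ l" using assms(2) by (simp add: point_rep_def)
    with elim assms(1)[of "q l" l] dist_triangle[of "\<alpha> b" "\<alpha> (q l)" x] show ?case
      by (simp add: close_test_def power_one_over dist_commute abs_if split: if_splits)
  qed
qed

text \<open>\<open>point_rep\<close> constrains each position separately, so a correct prefix can be
  continued by any sufficiently close entries. Hence the points with a name starting with
  \<open>w\<close> form exactly an intersection of balls.\<close>

lemma point_rep_extend: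
  fixes \<alpha> :: "nat \<Rightarrow> 'a :: complete_space"
  assumes "closure (range \<alpha>) = UNIV" and "\<And>i. i < length w \<Longrightarrow> dist (\<alpha> (w ! i)) x < 1 / 2 ^ i"
  obtains q where "point_rep \<alpha> q x" "map q [0..<length w] = w"
proof -
  have "\<exists>j. dist (\<alpha> j) x < 1 / 2 ^ n" for n
    using assms(1) closure_approachable[of x "range \<alpha>"] by fastforce
  then obtain c where c: "\<And>n. dist (\<alpha> (c n)) x < 1 / 2 ^ n" by metis
  show ?thesis
  proof
    show "point_rep \<alpha> (\<lambda>i. if i < length w then w ! i else c i) x"
      using assms(2) c by (simp add: point_rep_def)
    show "map (\<lambda>i. if i < length w then w ! i else c i) [0..<length w] = w"
      by (rule nth_equalityI) simp_all
  qed
qed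

section \<open>The reduced sets\<close>

definition shrink :: "(nat \<Rightarrow> 'a :: metric_space) \<Rightarrow> (nat \<Rightarrow> nat) \<Rightarrow> nat \<Rightarrow> 'a set" where
  "shrink \<alpha> p k = {x. \<exists>n w. p n = Suc (list_encode w) \<and>
     (\<forall>i < length w. dist (\<alpha> (w ! i)) x + 1 / 2 ^ k < 1 / 2 ^ i)}"

lemma open_shrink: "open (shrink \<alpha> p k)"
proof -
  have "shrink \<alpha> p k = (\<Union>n. \<Union>w \<in> {w. p n = Suc (list_encode w)}. \<Inter>i \<in> {..<length w}.
      {x. dist (\<alpha> (w ! i)) x + 1 / 2 ^ k < 1 / 2 ^ i})"
    by (auto simp: shrink_def)
  then show ?thesis
    by (simp only:) (intro open_UN ballI open_INT finite_lessThan open_Collect_less continuous_intros)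
qed

lemma shrink_mono: "k \<le> k' \<Longrightarrow> shrink \<alpha> p k \<subseteq> shrink \<alpha> p k'"
proof -
  assume "k \<le> k'"
  then have "1 / 2 ^ k' \<le> (1 / 2 ^ k :: real)" by (simp add: field_simps)
  then show ?thesis unfolding shrink_def by (blast intro: order_le_less_trans add_left_mono)
qed

text \<open>A word gives finitely many strict inequalities, and these leave a common positive
  margin.\<close>

lemma open_rep_subset_shrink:
  assumes "closure (range \<alpha>) = UNIV" "open_rep \<alpha> p U"
  shows "U \<subseteq> (\<Union>k. shrink \<alpha> p (Suc k))"
proof
  fix x assume "x \<in> U"
  obtain q where q: "point_rep \<alpha> q x"
    using point_rep_extend[OF assms(1), of "[]" x] by auto
  with \<open>x \<in> U\<close> assms(2) obtain n m where n: "p n = Suc (list_encode (map q [0..<m]))"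
    unfolding open_rep_def by blast
  have "eventually (\<lambda>k. dist (\<alpha> (q i)) x + 1 / 2 ^ Suc k < 1 / 2 ^ i) sequentially" for i
  proof (rule order_tendstoD(2))
    have "(\<lambda>k. dist (\<alpha> (q i)) x + (1 / 2) ^ Suc k) \<longlonglongrightarrow> dist (\<alpha> (q i)) x + 0"
      by (intro tendsto_intros LIMSEQ_Suc[OF LIMSEQ_power_zero]) simp
    then show "(\<lambda>k. dist (\<alpha> (q i)) x + 1 / 2 ^ Suc k) \<longlonglongrightarrow> dist (\<alpha> (q i)) x + 0"
      by (simp add: power_one_over)
  qed (use q in \<open>simp add: point_rep_def\<close>)
  then have "eventually (\<lambda>k. \<forall>i\<in>{..<m}. dist (\<alpha> (q i)) x + 1 / 2 ^ Suc k < 1 / 2 ^ i) sequentially"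
    by (simp add: eventually_ball_finite)
  then obtain k where "\<forall>i\<in>{..<m}. dist (\<alpha> (q i)) x + 1 / 2 ^ Suc k < 1 / 2 ^ i"
    by (auto simp: eventually_sequentially)
  then have "x \<in> shrink \<alpha> p (Suc k)"
    unfolding shrink_def using n by force
  then show "x \<in> (\<Union>k. shrink \<alpha> p (Suc k))" by blast
qed

text \<open>The margin at a common point \<open>y\<close> pays for the move from \<open>y\<close> to
  the centre \<open>x\<close>. So \<open>w\<close> starts a name of \<open>x\<close>, and then
  \<open>x\<close> is in \<open>U\<close> because \<open>p\<close> names \<open>U\<close>.\<close>

lemma ball_meets_shrink_imp_mem:
  assumes "closure (range \<alpha>) = UNIV" "open_rep \<alpha> p U"
    and "ball x (1 / 2 ^ k) \<inter> shrink \<alpha> p k \<noteq> {}"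
  shows "x \<in> U"
proof -
  obtain y n w where y: "dist x y < 1 / 2 ^ k" and n: "p n = Suc (list_encode w)"
    and w: "\<And>i. i < length w \<Longrightarrow> dist (\<alpha> (w ! i)) y + 1 / 2 ^ k < 1 / 2 ^ i"
    using assms(3) unfolding shrink_def by fastforce
  have "dist (\<alpha> (w ! i)) x < 1 / 2 ^ i" if "i < length w" for i
    using w[OF that] y dist_triangle[of "\<alpha> (w ! i)" x y] by (simp add: dist_commute)
  with assms(1) obtain q where "point_rep \<alpha> q x" "map q [0..<length w] = w"
    by (rule point_rep_extend)
  with n assms(2) show ?thesis unfolding open_rep_def by metis
qed

section \<open>Names of open sets built from tests\<close>

text \<open>
  Index \<open>t\<close> codes a word \<open>u\<close>, a witness \<open>n\<close> and a position \<open>l\<close>; \<open>u\<close> is emitted if it is longer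
  than \<open>l\<close> and its \<open>l\<close>-th entry passes the test \<open>R n\<close>.
\<close>

definition prefix_name :: "(nat \<Rightarrow> nat \<Rightarrow> nat \<Rightarrow> bool) \<Rightarrow> nat \<Rightarrow> nat" where
  "prefix_name R t =
     (if word_drop (pfst t) (psnd (psnd t)) \<noteq> 0 \<and>
         R (pfst (psnd t)) (word_nth (pfst t) (psnd (psnd t))) (psnd (psnd t))
      then Suc (pfst t) else 0)"

text \<open>Any prefix of \<open>q\<close> longer than \<open>l\<close> shows the entry
  \<open>q l\<close>, and the prefix of length \<open>Suc l\<close> already suffices.\<close>

lemma prefix_name_enumerates_iff:
  "(\<exists>t m. prefix_name R t = Suc (list_encode (map q [0..<m]))) \<longleftrightarrow> (\<exists>n l. R n (q l) l)"
proof
  assume "\<exists>t m. prefix_name R t = Suc (list_encode (map q [0..<m]))"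
  then obtain t m where "prefix_name R t = Suc (list_encode (map q [0..<m]))" by blast
  then have t: "pfst t = list_encode (map q [0..<m])"
    and "word_drop (pfst t) (psnd (psnd t)) \<noteq> 0"
    and R: "R (pfst (psnd t)) (word_nth (pfst t) (psnd (psnd t))) (psnd (psnd t))"
    by (auto simp: prefix_name_def split: if_splits)
  then have "psnd (psnd t) < m" by (simp add: word_drop_eq_0_iff)
  with R t show "\<exists>n l. R n (q l) l" by (auto simp: word_nth_list_encode)
next
  assume "\<exists>n l. R n (q l) l"
  then obtain n l where "R n (q l) l" by blast
  then have "prefix_name R (prod_encode (list_encode (map q [0..<Suc l]), prod_encode (n, l)))
      = Suc (list_encode (map q [0..<Suc l]))"
    by (simp add: prefix_name_def word_drop_eq_0_iff word_nth_list_encode nth_append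
        del: upt_Suc list_encode.simps)
  then show "\<exists>t m. prefix_name R t = Suc (list_encode (map q [0..<m]))" by blast
qed

lemma open_rep_prefix_name:
  assumes "open U" and "\<And>q x. point_rep \<alpha> q x \<Longrightarrow> x \<in> U \<longleftrightarrow> (\<exists>n l. R n (q l) l)"
  shows "open_rep \<alpha> (prefix_name R) U"
  unfolding open_rep_def prefix_name_enumerates_iff using assms by blast

text \<open>The single entry \<open>a\<close> is tested against all balls of the \<open>n\<close>-th
  word. Since 0 means no word, the word has the code \<open>p n - 1\<close>, which also bounds its
  positions; those past its end are skipped by the \<open>word_drop\<close> condition.\<close>

definition shrink_test :: "(nat \<Rightarrow> nat) \<Rightarrow> (nat \<Rightarrow> nat) \<Rightarrow> nat \<Rightarrow> nat \<Rightarrow> nat \<Rightarrow> nat \<Rightarrow> bool" where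
  "shrink_test f p k n a l \<longleftrightarrow> p n \<noteq> 0 \<and>
     (\<forall>i < p n - 1. word_drop (p n - 1) i \<noteq> 0 \<longrightarrow> close_test f (word_nth (p n - 1) i) a l k i)"

lemma shrink_test_iff:
  "shrink_test f p k n a l \<longleftrightarrow>
     (\<exists>w. p n = Suc (list_encode w) \<and> (\<forall>i < length w. close_test f (w ! i) a l k i))"
proof (cases "p n")
  case (Suc c)
  obtain w where c: "c = list_encode w" by (metis list_decode_inverse)
  show ?thesis
    using length_le_list_encode[of w]
    by (auto simp: shrink_test_def Suc c word_drop_eq_0_iff word_nth_list_encode list_encode_eq not_le)
qed (simp add: shrink_test_def)

lemma open_rep_shrink:
  fixes \<alpha> :: "nat \<Rightarrow> 'a :: complete_space"
  assumes f: "\<And>i j k. \<bar>dist (\<alpha> i) (\<alpha> j) - rat_code (f (prod_encode (i, prod_encode (j, k))))\<bar> \<le> 1 / 2 ^ k"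
  shows "open_rep \<alpha> (prefix_name (shrink_test f p k)) (shrink \<alpha> p k)"
proof (rule open_rep_prefix_name[OF open_shrink])
  fix q x assume q: "point_rep \<alpha> q x"
  show "x \<in> shrink \<alpha> p k \<longleftrightarrow> (\<exists>n l. shrink_test f p k n (q l) l)"
  proof
    assume "x \<in> shrink \<alpha> p k"
    then obtain n w where n: "p n = Suc (list_encode w)"
      and w: "\<And>i. i < length w \<Longrightarrow> dist (\<alpha> (w ! i)) x + 1 / 2 ^ k < 1 / 2 ^ i"
      by (auto simp: shrink_def)
    \<comment> \<open>One position \<open>l\<close> has to serve all balls of the word at
      once.\<close>
    have "eventually (\<lambda>l. \<forall>i\<in>{..<length w}. close_test f (w ! i) (q l) l k i) sequentially"
      by (intro eventually_ball_finite ballI eventually_close_test[of \<alpha> _ f, OF f q] w) auto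
    then obtain l where "\<forall>i\<in>{..<length w}. close_test f (w ! i) (q l) l k i"
      by (auto simp: eventually_sequentially)
    with n show "\<exists>n l. shrink_test f p k n (q l) l" by (auto simp: shrink_test_iff)
  next
    assume "\<exists>n l. shrink_test f p k n (q l) l"
    then obtain n l w where "p n = Suc (list_encode w)"
      and "\<And>i. i < length w \<Longrightarrow> close_test f (w ! i) (q l) l k i"
      by (auto simp: shrink_test_iff)
    moreover have "dist (\<alpha> (q l)) x < 1 / 2 ^ l" using q by (simp add: point_rep_def)
    ultimately show "x \<in> shrink \<alpha> p k"
      unfolding shrink_def using close_test_sound[of \<alpha> _ _ f, OF f] by blast
  qed
qed

lemma open_rep_ball:
  fixes \<alpha> :: "nat \<Rightarrow> 'a :: complete_space"
  assumes f: "\<And>i j k. \<bar>dist (\<alpha> i) (\<alpha> j) - rat_code (f (prod_encode (i, prod_encode (j, k))))\<bar> \<le> 1 / 2 ^ k"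
  shows "open_rep \<alpha> (prefix_name (\<lambda>n a l. close_test f b a l (Suc k) k)) (ball (\<alpha> b) (1 / 2 ^ Suc k))"
proof (rule open_rep_prefix_name[OF open_ball])
  fix q x assume q: "point_rep \<alpha> q x"
  \<comment> \<open>Halving makes radius and margin equal:
    \<open>1 / 2 ^ k - 1 / 2 ^ Suc k = 1 / 2 ^ Suc k\<close>. So \<open>close_test\<close> covers
    this ball too, and levels are counted as \<open>Suc k\<close>.\<close>
  have "x \<in> ball (\<alpha> b) (1 / 2 ^ Suc k) \<longleftrightarrow> dist (\<alpha> b) x + 1 / 2 ^ Suc k < 1 / 2 ^ k"
    by (simp add: field_simps)
  also have "\<dots> \<longleftrightarrow> (\<exists>l. close_test f b (q l) l (Suc k) k)"
  proof
    assume "dist (\<alpha> b) x + 1 / 2 ^ Suc k < 1 / 2 ^ k"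
    from eventually_close_test[of \<alpha> _ f, OF f q this] show "\<exists>l. close_test f b (q l) l (Suc k) k"
      by (auto simp: eventually_sequentially)
  next
    assume "\<exists>l. close_test f b (q l) l (Suc k) k"
    with q show "dist (\<alpha> b) x + 1 / 2 ^ Suc k < 1 / 2 ^ k"
      unfolding point_rep_def using close_test_sound[of \<alpha> _ _ f, OF f] by blast
  qed
  finally show "x \<in> ball (\<alpha> b) (1 / 2 ^ Suc k) \<longleftrightarrow> (\<exists>(n::nat) l. close_test f b (q l) l (Suc k) k)"
    by simp
qed

section \<open>Computability of the names and of their measures\<close>

lemma decidable_close_test:
  assumes "computable_fun f" "total_rec b" "total_rec a" "total_rec l" "total_rec k" "total_rec i"
  shows "decidable (\<lambda>p n. close_test f (b p n) (a p n) (l p n) (k p n) (i p n))"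
proof -
  have "total_rec (\<lambda>p n. f n)" using assms(1) by (simp add: computable_fun_def total_rec_def)
  from total_rec_comp[OF this total_rec_pair[OF assms(2) total_rec_pair[OF assms(3,4)]]]
  show ?thesis unfolding close_test_def by (rule decidable_rat_code_less_power2) (rule assms)+
qed

text \<open>The level is the first component of the input, so that one function yields the names for
  all levels; the hypothesis reads its input as \<open>(k, (n, (a, l)))\<close>.\<close>

lemma total_rec_prefix_name:
  assumes "decidable (\<lambda>p m. R p (pfst m) (pfst (psnd m)) (pfst (psnd (psnd m))) (psnd (psnd (psnd m))))"
  shows "total_rec (\<lambda>p m. prefix_name (R p (pfst m)) (psnd m))"
proof -
  let ?t = "\<lambda>m. prod_encode (pfst m, prod_encode (pfst (psnd (psnd m)),
    prod_encode (word_nth (pfst (psnd m)) (psnd (psnd (psnd m))), psnd (psnd (psnd m)))))"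
  have "total_rec (\<lambda>p m. ?t m)"
    by (intro total_rec_basic total_rec_word_nth)
  from total_rec_comp[OF assms[unfolded decidable_def] this]
  have "decidable (\<lambda>p m. R p (pfst m) (pfst (psnd (psnd m)))
      (word_nth (pfst (psnd m)) (psnd (psnd (psnd m)))) (psnd (psnd (psnd m))))"
    by (simp add: decidable_def)
  then show ?thesis unfolding prefix_name_def
    by (intro total_rec_if decidable_conj decidable_not_zero total_rec_basic total_rec_word_drop)
qed

lemma total_rec_shrink_name:
  assumes "computable_fun f"
  shows "total_rec (\<lambda>p m. prefix_name (shrink_test f p (Suc (pfst m))) (psnd m))"
proof (rule total_rec_prefix_name[where R = "\<lambda>p k. shrink_test f p (Suc k)"])
  show "decidable (\<lambda>p m. shrink_test f p (Suc (pfst m)) (pfst (psnd m)) (pfst (psnd (psnd m)))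
      (psnd (psnd (psnd m))))"
    unfolding shrink_test_def
    by (intro decidable_conj decidable_not_zero decidable_all_less decidable_imp
        decidable_close_test[OF assms] total_rec_basic total_rec_word_drop total_rec_word_nth
        total_rec_diff)
qed

lemma total_rec_ball_name:
  assumes "computable_fun f"
  shows "total_rec (\<lambda>p m. prefix_name (\<lambda>n a l. close_test f b a l (Suc (pfst m)) (pfst m)) (psnd m))"
  by (intro total_rec_prefix_name[where R = "\<lambda>p k n a l. close_test f b a l (Suc k) k"]
      decidable_close_test total_rec_basic assms)

text \<open>\<open>V\<close> asks for a correct name at every oracle \<open>p\<close>, even at one
  that names no open set. The machine for the measure thus converges everywhere, and the result is a
  total function, fit for use in a decidable test.\<close>

lemma computable_measure_total_rec:
  assumes "computable_measure \<alpha> M" and r: "total_rec (\<lambda>p m. r p (pfst m) (psnd m))"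
    and V: "\<And>p k. open_rep \<alpha> (r p k) (V p k)"
  obtains v where "total_rec (\<lambda>p m. v p (pfst m) (psnd m))"
    and "\<And>p k. lower_real_rep (v p k) (measure M (V p k))"
proof -
  obtain F where F: "partrec F"
    and meas: "\<And>p U. open_rep \<alpha> p U \<Longrightarrow>
      \<exists>q. (\<forall>n. F p n = Some (q n)) \<and> lower_real_rep q (measure M U)"
    using assms(1) unfolding computable_measure_def computable_map_def by blast
  from meas[OF V] obtain v where v: "\<And>p k n. F (r p k) n = Some (v p k n)"
    and "\<And>p k. lower_real_rep (v p k) (measure M (V p k))"
    by metis
  moreover have "total_rec (\<lambda>p m. v p (pfst m) (psnd m))"
    using partrec_oracle_subst[OF F r] by (simp add: v total_rec_def)
  ultimately show ?thesis using that by blast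
qed

text \<open>Exceeding a number strictly is witnessed by one term of a supremum; this is applied to
  one summand after the other.\<close>

lemma lower_real_rep_sum_gt_iff:
  assumes "lower_real_rep p x" "lower_real_rep q y"
  shows "c < x + y \<longleftrightarrow> (\<exists>s t. c < rat_code (p s) + rat_code (q t))"
proof -
  have x: "a < x \<longleftrightarrow> (\<exists>s. a < rat_code (p s))" for a
    using assms(1) by (simp add: lower_real_rep_def less_cSUP_iff)
  have y: "a < y \<longleftrightarrow> (\<exists>t. a < rat_code (q t))" for a
    using assms(2) by (simp add: lower_real_rep_def less_cSUP_iff)
  have "c < x + y \<longleftrightarrow> c - y < x" by linarith
  also have "\<dots> \<longleftrightarrow> (\<exists>s. c - rat_code (p s) < y)" unfolding x by (simp add: algebra_simps)
  also have "\<dots> \<longleftrightarrow> (\<exists>s t. c < rat_code (p s) + rat_code (q t))" unfolding y by (simp add: algebra_simps)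
  finally show ?thesis .
qed

section \<open>Balls of equal measure and compactness\<close>

lemma dense_range_ball_cover:
  fixes \<alpha> :: "nat \<Rightarrow> 'a :: metric_space"
  assumes "closure (range \<alpha>) = UNIV" "r > 0"
  shows "(\<Union>j. ball (\<alpha> j) r) = UNIV"
proof -
  have "\<exists>j. dist (\<alpha> j) x < r" for x
    using assms closure_approachable[of x "range \<alpha>"] by fastforce
  then show ?thesis by auto
qed

text \<open>If one ball of radius \<open>r\<close> were null, all would be, yet countably many of
  them cover the space.\<close>

lemma uniform_ball_measure_pos:
  fixes \<alpha> :: "nat \<Rightarrow> 'a :: metric_space" and \<mu> :: "'a measure"
  assumes "prob_space \<mu>" and sets: "sets \<mu> = sets borel" and dense: "closure (range \<alpha>) = UNIV"
    and unif: "\<And>x y. measure \<mu> (ball x r) = measure \<mu> (ball y r)" and "r > 0"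
  shows "measure \<mu> (ball x r) > 0"
proof (rule ccontr)
  interpret prob_space \<mu> by fact
  assume "\<not> measure \<mu> (ball x r) > 0"
  then have "measure \<mu> (ball y r) = 0" for y
    using unif[of y x] measure_nonneg[of \<mu> "ball x r"] by linarith
  then have "emeasure \<mu> (\<Union>j. ball (\<alpha> j) r) = 0"
    by (intro emeasure_UN_eq_0) (auto simp: emeasure_eq_measure sets)
  moreover have "space \<mu> = UNIV" using sets_eq_imp_space_eq[OF sets] by simp
  ultimately show False
    using emeasure_space_1 dense_range_ball_cover[OF dense \<open>r > 0\<close>] by simp
qed

lemma (in prob_space) meets_if_prob_sum_gt_1:
  assumes "A \<in> events" "B \<in> events" "prob A + prob B > 1"
  shows "A \<inter> B \<noteq> {}"
proof
  assume "A \<inter> B = {}"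
  then have "prob (A \<union> B) = prob A + prob B" using assms by (intro finite_measure_Union) auto
  with assms(3) prob_le_1[of "A \<union> B"] show False by simp
qed

lemma uniform_ball_measure_imp_compact:
  fixes \<alpha> :: "nat \<Rightarrow> 'a :: complete_space" and \<mu> :: "'a measure"
  assumes "prob_space \<mu>" and sets: "sets \<mu> = sets borel" and dense: "closure (range \<alpha>) = UNIV"
    and unif: "\<And>r x y. r > 0 \<Longrightarrow> measure \<mu> (ball x r) = measure \<mu> (ball y r)"
  shows "compact (UNIV :: 'a set)"
  unfolding compact_eq_totally_bounded
proof (intro conjI allI impI)
  interpret prob_space \<mu> by fact
  show "complete (UNIV :: 'a set)" by (rule complete_UNIV)
  fix \<epsilon> :: real assume "\<epsilon> > 0"
  \<comment> \<open>A ball of radius \<open>r\<close> that meets another one has its centre within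
    \<open>2 * r\<close> of the other centre.\<close>
  define r where "r = \<epsilon> / 2"
  have r: "r > 0" using \<open>\<epsilon> > 0\<close> by (simp add: r_def)
  define g where "g = measure \<mu> (ball undefined r)"
  have g: "measure \<mu> (ball x r) = g" for x unfolding g_def by (rule unif[OF r])
  have "g > 0" unfolding g_def
    by (rule uniform_ball_measure_pos[OF assms(1) sets dense unif[OF r] r])
  let ?A = "\<lambda>N. \<Union>j<N. ball (\<alpha> j) r"
  have A: "?A N \<in> events" for N by (auto simp: sets)
  have "(\<lambda>N. prob (?A N)) \<longlonglongrightarrow> prob (\<Union>N. ?A N)"
    using A by (intro finite_Lim_measure_incseq) (auto simp: incseq_def intro: less_le_trans)
  also have "(\<Union>N. ?A N) = (\<Union>j. ball (\<alpha> j) r)" by blast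
  also have "\<dots> = space \<mu>"
    using dense_range_ball_cover[OF dense r] sets_eq_imp_space_eq[OF sets] by simp
  finally have "(\<lambda>N. prob (?A N)) \<longlonglongrightarrow> 1" by (simp add: prob_space)
  \<comment> \<open>Finitely many balls leave less than \<open>g\<close> of the measure uncovered,
    too little for a further ball of radius \<open>r\<close> to be disjoint from them.\<close>
  then have "eventually (\<lambda>N. prob (?A N) > 1 - g) sequentially"
    by (rule order_tendstoD(1)) (use \<open>g > 0\<close> in simp)
  then obtain N where N: "prob (?A N) > 1 - g" by (auto simp: eventually_sequentially)
  have "x \<in> (\<Union>y \<in> \<alpha> ` {..<N}. ball y \<epsilon>)" for x
  proof -
    have "ball x r \<inter> ?A N \<noteq> {}"
      using N g[of x] A by (intro meets_if_prob_sum_gt_1) (auto simp: sets)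
    then obtain y j where "dist x y < r" "j < N" "dist (\<alpha> j) y < r" by auto
    then have "dist (\<alpha> j) x < \<epsilon>"
      using dist_triangle[of "\<alpha> j" x y] by (simp add: r_def dist_commute)
    with \<open>j < N\<close> show ?thesis by auto
  qed
  then show "\<exists>k. finite k \<and> (UNIV :: 'a set) \<subseteq> (\<Union>y\<in>k. ball y \<epsilon>)"
    by (intro exI[of _ "\<alpha> ` {..<N}"]) auto
qed

lemma open_rep_UNIV_iff_shrink_measure:
  fixes \<alpha> :: "nat \<Rightarrow> 'a :: complete_space" and \<mu> :: "'a measure"
  assumes "prob_space \<mu>" and sets: "sets \<mu> = sets borel" and dense: "closure (range \<alpha>) = UNIV"
    and unif: "\<And>r x y. r > 0 \<Longrightarrow> measure \<mu> (ball x r) = measure \<mu> (ball y r)"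
    and U: "open_rep \<alpha> p U"
  shows "U = UNIV \<longleftrightarrow>
    (\<exists>k. 1 < measure \<mu> (shrink \<alpha> p (Suc k)) + measure \<mu> (ball (\<alpha> b) (1 / 2 ^ Suc k)))"
proof
  interpret prob_space \<mu> by fact
  assume "U = UNIV"
  have "compact (UNIV :: 'a set)"
    by (rule uniform_ball_measure_imp_compact[OF assms(1) sets dense unif])
  moreover have "UNIV \<subseteq> (\<Union>k. shrink \<alpha> p (Suc k))"
    using open_rep_subset_shrink[OF dense U] \<open>U = UNIV\<close> by simp
  ultimately obtain K where K: "finite K" "UNIV \<subseteq> (\<Union>k\<in>K. shrink \<alpha> p (Suc k))"
    using open_shrink by (metis compactE_image)
  \<comment> \<open>The sets increase with the level, so a finite subcover reduces to its largest
    member.\<close>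
  have "shrink \<alpha> p (Suc k) \<subseteq> shrink \<alpha> p (Suc (Max K))" if "k \<in> K" for k
    using K(1) that by (intro shrink_mono) simp
  with K(2) have "shrink \<alpha> p (Suc (Max K)) = space \<mu>"
    using sets_eq_imp_space_eq[OF sets] by auto
  moreover have "measure \<mu> (ball (\<alpha> b) (1 / 2 ^ Suc (Max K))) > 0"
    by (rule uniform_ball_measure_pos[OF assms(1) sets dense unif]) simp_all
  ultimately show "\<exists>k. 1 < measure \<mu> (shrink \<alpha> p (Suc k)) + measure \<mu> (ball (\<alpha> b) (1 / 2 ^ Suc k))"
    by (intro exI[of _ "Max K"]) (simp add: prob_space)
next
  interpret prob_space \<mu> by fact
  assume "\<exists>k. 1 < measure \<mu> (shrink \<alpha> p (Suc k)) + measure \<mu> (ball (\<alpha> b) (1 / 2 ^ Suc k))"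
  then obtain k where k: "1 < prob (shrink \<alpha> p (Suc k)) + prob (ball (\<alpha> b) (1 / 2 ^ Suc k))" by blast
  have "x \<in> U" for x
  proof (rule ball_meets_shrink_imp_mem[OF dense U])
    \<comment> \<open>Only balls around the fixed centre \<open>\<alpha> b\<close> are measured;
      uniformity transfers their measure to every \<open>x\<close>.\<close>
    have "prob (ball x (1 / 2 ^ Suc k)) = prob (ball (\<alpha> b) (1 / 2 ^ Suc k))" by (rule unif) simp
    with k show "ball x (1 / 2 ^ Suc k) \<inter> shrink \<alpha> p (Suc k) \<noteq> {}"
      by (intro meets_if_prob_sum_gt_1) (auto simp: sets open_shrink)
  qed
  then show "U = UNIV" by blast
qed

section \<open>The search for a level and two rational lower bounds\<close>

theorem theorem6:
  fixes \<alpha> :: "nat \<Rightarrow> 'a :: complete_space" and \<mu> :: "'a measure"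
  assumes "computable_metric \<alpha>"
    and "prob_space \<mu>" and "sets \<mu> = sets borel"
    and "computable_measure \<alpha> \<mu>"
    and "\<forall>r>0. \<forall>x y. measure \<mu> (ball x r) = measure \<mu> (ball y r)"
  shows "computably_compact \<alpha>"
proof -
  from assms(1) obtain f where dense: "closure (range \<alpha>) = UNIV" and comp_f: "computable_fun f"
    and f: "\<And>i j k. \<bar>dist (\<alpha> i) (\<alpha> j) - rat_code (f (prod_encode (i, prod_encode (j, k))))\<bar> \<le> 1 / 2 ^ k"
    unfolding computable_metric_def by blast
  obtain v where v: "total_rec (\<lambda>p m. v p (pfst m) (psnd m))"
    "\<And>p k. lower_real_rep (v p k) (measure \<mu> (shrink \<alpha> p (Suc k)))"
    by (rule computable_measure_total_rec[OF assms(4) total_rec_shrink_name[OF comp_f]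
          open_rep_shrink[OF f]]) (blast intro: that)
  obtain g where g: "total_rec (\<lambda>p m. g p (pfst m) (psnd m))"
    "\<And>p k. lower_real_rep (g p k) (measure \<mu> (ball (\<alpha> 0) (1 / 2 ^ Suc k)))"
    by (rule computable_measure_total_rec[OF assms(4) total_rec_ball_name[OF comp_f]
          open_rep_ball[OF f]]) (blast intro: that)
  \<comment> \<open>Here \<open>m\<close> codes \<open>(input, (k, (s, t)))\<close>: the dummy
    input, the level, and the positions in the two enumerations of lower bounds.\<close>
  let ?P = "\<lambda>p m. 1 < rat_code (v p (pfst (psnd m)) (pfst (psnd (psnd m)))) +
    rat_code (g p (pfst (psnd m)) (psnd (psnd (psnd m))))"
  have "total_rec (\<lambda>p m. v p (pfst (psnd m)) (pfst (psnd (psnd m))))"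
    using total_rec_comp[OF v(1), of "\<lambda>p m. prod_encode (pfst (psnd m), pfst (psnd (psnd m)))"]
    by (simp add: total_rec_basic)
  moreover have "total_rec (\<lambda>p m. g p (pfst (psnd m)) (psnd (psnd (psnd m))))"
    using total_rec_comp[OF g(1), of "\<lambda>p m. prod_encode (pfst (psnd m), psnd (psnd (psnd m)))"]
    by (simp add: total_rec_basic)
  ultimately have "decidable ?P" by (rule decidable_rat_code_sum_gt_1)
  from partrec_search[OF this] obtain F where F: "partrec F"
    and halts: "\<And>p n. F p n \<noteq> None \<longleftrightarrow> (\<exists>m. ?P p (prod_encode (n, m)))" by blast
  have "U = UNIV \<longleftrightarrow> F p 0 \<noteq> None" if "open_rep \<alpha> p U" for p U
  proof -
    have "U = UNIV \<longleftrightarrow>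
      (\<exists>k. 1 < measure \<mu> (shrink \<alpha> p (Suc k)) + measure \<mu> (ball (\<alpha> 0) (1 / 2 ^ Suc k)))"
      using assms(5) by (intro open_rep_UNIV_iff_shrink_measure[OF assms(2,3) dense _ that]) simp
    also have "\<dots> \<longleftrightarrow> (\<exists>k s t. 1 < rat_code (v p k s) + rat_code (g p k t))"
      by (simp only: lower_real_rep_sum_gt_iff[OF v(2)[of p] g(2)[of p]])
    also have "\<dots> \<longleftrightarrow> F p 0 \<noteq> None"
    proof
      assume "\<exists>k s t. 1 < rat_code (v p k s) + rat_code (g p k t)"
      then obtain k s t where "1 < rat_code (v p k s) + rat_code (g p k t)" by blast
      then have "?P p (prod_encode (0, prod_encode (k, prod_encode (s, t))))" by simp
      then show "F p 0 \<noteq> None" unfolding halts by (rule exI)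
    qed (unfold halts, blast)
    finally show ?thesis .
  qed
  then show ?thesis
    unfolding computably_compact_def semidecidable_def using F by blast
qed

end
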